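(* If $G$ is a connected graph of order $n\ge 2$, then $\alpha_{\mathrm{bn}}(G)=n-1$ if and only if $G$ is a path or a spider.
   Context: Graphs are finite and simple; $d$ is graph distance and $e(v)$ is the eccentricity of $v$. A broadcast on a nontrivial connected graph $G=(V,E)$ is a function $f:V\to\{0,1,\dots,\operatorname{diam}(G)\}$ with $f(v)\le e(v)$ for all $v\in V$. Its weight is $\sigma(f)=\sum_{v\in V}f(v)$. Let $V_f^+=\{v\in V: f(v)>0\}$. A vertex $u$ hears $f$ from $v\in V_f^+$ if $d(u,v)\le f(v)$ (so a broadcasting vertex hears itself). A broadcast $f$ is bn-independent (boundary independent) if whenever a vertex $x$ hears $f$ from more than one vertex of $V_f^+$, then $d(x,u)\ge f(u)$ for all $u\in V_f^+$ (equivalently, $d(x,u)=f(u)$ for every $u\in V_f^+$ from which $x$ hears $f$). $\alpha_{\mathrm{bn}}(G)$ is the maximum weight of a bn-independent broadcast on $G$. For $k\ge 3$ and $n_1,\dots,n_k\ge 1$, the (generalized) spider $\operatorname{Sp}(n_1,\dots,n_k)$ is the tree obtained from a vertex $b$ (the head, of degree $k$) by attaching $k$ legs, i.e. $k$ paths starting at $b$, pairwise disjoint except for $b$, of lengths (numbers of edges) $n_1,\dots,n_k$. A graph is a spider if it is isomorphic to some $\operatorname{Sp}(n_1,\dots,n_k)$ with $k\ge3$ and all $n_i\ge1$. *)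

theory Defs
  imports "Graph_Theory.Graph_Theory" "HOL-Library.FuncSet"
begin

text \<open>
  A finite simple graph is a \<^locale>\<open>pair_graph\<close>: a finite, loop-free digraph without parallel
  arcs whose arc relation is symmetric, so that an edge \<open>uv\<close> is the pair of arcs \<open>(u,v)\<close>, \<open>(v,u)\<close>.
\<close>

section \<open>Distance\<close>

definition gdist :: "'a pair_pre_digraph \<Rightarrow> 'a \<Rightarrow> 'a \<Rightarrow> nat" where
  "gdist G u v = Inf {length p |p. pre_digraph.awalk (with_proj G) u p v}"

definition ecc :: "'a pair_pre_digraph \<Rightarrow> 'a \<Rightarrow> nat" where
  "ecc G v = Max (gdist G v ` pverts G)"

definition diam :: "'a pair_pre_digraph \<Rightarrow> nat" where
  "diam G = Max (ecc G ` pverts G)"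

text \<open>
  The infimum of the empty set of naturals is 0, so \<open>gdist\<close> is meaningful only between vertices
  joined by a walk; there it is the library's shortest-path distance for unit weights.
\<close>

lemma gdist_eq_\<mu>:
  assumes "wf_digraph (with_proj G)" and "reachable (with_proj G) u v"
  shows "ereal (real (gdist G u v)) = wf_digraph.\<mu> (with_proj G) (\<lambda>_. 1) u v"
proof -
  interpret wf_digraph "with_proj G" by fact
  let ?W = "{p. awalk u p v}"
  have cost: "awalk_cost (\<lambda>_. 1) p = real (length p)" for p :: "('a \<times> 'a) list"
    by (induction p) auto
  have ne: "?W \<noteq> {}" using assms(2) by (auto simp: reachable_awalk)
  have "gdist G u v \<in> {length p |p. awalk u p v}"
    unfolding gdist_def using ne by (intro Inf_nat_def1) auto
  then obtain p where p: "awalk u p v" "length p = gdist G u v" by auto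
  have least: "gdist G u v \<le> length q" if "awalk u q v" for q
    unfolding gdist_def using that by (intro wellorder_Inf_le1) auto
  have "(INF p\<in>?W. ereal (real (length p))) = ereal (real (gdist G u v))"
  proof (rule antisym)
    show "(INF p\<in>?W. ereal (real (length p))) \<le> ereal (real (gdist G u v))"
      using p by (intro INF_lower2[of p]) auto
    show "ereal (real (gdist G u v)) \<le> (INF p\<in>?W. ereal (real (length p)))"
      using least by (intro INF_greatest) auto
  qed
  then show ?thesis unfolding \<mu>_def cost by simp
qed

section \<open>Boundary independent broadcasts\<close>

text \<open>Only the values on the vertex set matter; \<open>f\<close> is unconstrained elsewhere.\<close>

definition broadcast :: "'a pair_pre_digraph \<Rightarrow> ('a \<Rightarrow> nat) \<Rightarrow> bool" where
  "broadcast G f \<longleftrightarrow>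
     f \<in> pverts G \<rightarrow> {0..diam G} \<and> (\<forall>v\<in>pverts G. f v \<le> ecc G v)"

definition weight :: "'a pair_pre_digraph \<Rightarrow> ('a \<Rightarrow> nat) \<Rightarrow> nat" where
  "weight G f = (\<Sum>v\<in>pverts G. f v)"

definition broadcasting :: "'a pair_pre_digraph \<Rightarrow> ('a \<Rightarrow> nat) \<Rightarrow> 'a set" where
  "broadcasting G f = {v \<in> pverts G. f v > 0}"

definition hears :: "'a pair_pre_digraph \<Rightarrow> ('a \<Rightarrow> nat) \<Rightarrow> 'a \<Rightarrow> 'a \<Rightarrow> bool" where
  "hears G f u v \<longleftrightarrow> v \<in> broadcasting G f \<and> gdist G u v \<le> f v"

definition bn_independent :: "'a pair_pre_digraph \<Rightarrow> ('a \<Rightarrow> nat) \<Rightarrow> bool" where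
  "bn_independent G f \<longleftrightarrow>
     (\<forall>x\<in>pverts G. card {v. hears G f x v} > 1 \<longrightarrow>
        (\<forall>u\<in>broadcasting G f. gdist G x u \<ge> f u))"

definition alpha_bn :: "'a pair_pre_digraph \<Rightarrow> nat" where
  "alpha_bn G = Max (weight G ` {f. broadcast G f \<and> bn_independent G f})"

lemma alpha_bn_attained:
  assumes "finite (pverts G)"
  shows "\<exists>f. broadcast G f \<and> bn_independent G f \<and> weight G f = alpha_bn G"
    and "broadcast G g \<Longrightarrow> bn_independent G g \<Longrightarrow> weight G g \<le> alpha_bn G"
proof -
  let ?A = "weight G ` {f. broadcast G f \<and> bn_independent G f}"
  have "weight G f \<le> card (pverts G) * diam G" if "broadcast G f" for f
  proof -
    have "f v \<le> diam G" if "v \<in> pverts G" for v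
      using \<open>broadcast G f\<close> that by (auto simp: broadcast_def)
    then show ?thesis
      unfolding weight_def using sum_bounded_above[of "pverts G" f "diam G"] by simp
  qed
  then have fin: "finite ?A"
    by (intro finite_subset[of ?A "{..card (pverts G) * diam G}"]) auto
  have "broadcast G (\<lambda>_. 0)" "bn_independent G (\<lambda>_. 0)"
    by (auto simp: broadcast_def bn_independent_def broadcasting_def)
  then have "?A \<noteq> {}" by blast
  with fin have "alpha_bn G \<in> ?A" unfolding alpha_bn_def by (rule Max_in)
  then show "\<exists>f. broadcast G f \<and> bn_independent G f \<and> weight G f = alpha_bn G" by auto
  show "weight G g \<le> alpha_bn G" if "broadcast G g" "bn_independent G g"
    unfolding alpha_bn_def using fin that by (intro Max_ge) auto
qed

section \<open>Paths and spiders\<close>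

definition path_graph :: "nat \<Rightarrow> nat pair_pre_digraph" where
  "path_graph m =
     (let E = {(i, Suc i) |i. Suc i < m} in \<lparr> pverts = {..<m}, parcs = E \<union> E\<inverse> \<rparr>)"

definition is_path :: "'a pair_pre_digraph \<Rightarrow> bool" where
  "is_path G \<longleftrightarrow> (\<exists>m\<ge>1. digraph_iso (with_proj G) (with_proj (path_graph m)))"

text \<open>
  \<open>Leg i j\<close> is the vertex at distance \<open>j\<close> from the head on the \<open>i\<close>-th leg; legs are numbered
  from 0, positions on a leg from 1.
\<close>

datatype spider_vertex = Head | Leg nat nat

definition Sp :: "nat list \<Rightarrow> spider_vertex pair_pre_digraph" where
  "Sp ns =
     (let E = {(Head, Leg i 1) |i. i < length ns \<and> 1 \<le> ns ! i} \<union>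
              {(Leg i j, Leg i (Suc j)) |i j. i < length ns \<and> 1 \<le> j \<and> Suc j \<le> ns ! i}
      in \<lparr> pverts = {Head} \<union> {Leg i j |i j. i < length ns \<and> 1 \<le> j \<and> j \<le> ns ! i},
           parcs = E \<union> E\<inverse> \<rparr>)"

definition is_spider :: "'a pair_pre_digraph \<Rightarrow> bool" where
  "is_spider G \<longleftrightarrow>
     (\<exists>ns. length ns \<ge> 3 \<and> (\<forall>n\<in>set ns. n \<ge> 1) \<and>
        digraph_iso (with_proj G) (with_proj (Sp ns)))"

lemma pair_graph_path_graph: "pair_graph (path_graph m)"
proof -
  have "finite (parcs (path_graph m))"
    by (rule finite_subset[of _ "{..<m} \<times> {..<m}"]) (auto simp: path_graph_def Let_def)
  then show ?thesis
    by unfold_locales (auto simp: path_graph_def symmetric_def sym_def Let_def)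
qed

lemma pair_graph_Sp: "pair_graph (Sp ns)"
proof -
  have V: "pverts (Sp ns) = {Head} \<union> (\<Union>i<length ns. Leg i ` {1..ns ! i})"
    by (auto simp: Sp_def Let_def)
  have A: "parcs (Sp ns) \<subseteq> pverts (Sp ns) \<times> pverts (Sp ns)"
    by (auto simp: Sp_def Let_def)
  have fin: "finite (pverts (Sp ns))" unfolding V by auto
  have "finite (parcs (Sp ns))"
    using A fin by (meson finite_SigmaI finite_subset)
  moreover have "symmetric (with_proj (Sp ns))"
    unfolding symmetric_def with_proj_simps by (auto simp: Sp_def Let_def sym_def)
  moreover have "fst e \<noteq> snd e" if "e \<in> parcs (Sp ns)" for e
    using that by (auto simp: Sp_def Let_def)
  ultimately show ?thesis
    using fin A by unfold_locales (auto simp: mem_Times_iff)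
qed

text \<open>
  For graphs in the above sense, \<open>digraph_iso\<close> is the existence of an adjacency-preserving
  bijection of the vertex sets.
\<close>

lemma digraph_iso_pair_iff:
  fixes G :: "'a pair_pre_digraph" and H :: "'b pair_pre_digraph"
  assumes "pair_graph G" and "pair_graph H"
  shows "digraph_iso (with_proj G) (with_proj H) \<longleftrightarrow>
    (\<exists>\<phi>. bij_betw \<phi> (pverts G) (pverts H) \<and>
       (\<forall>u\<in>pverts G. \<forall>v\<in>pverts G. (u, v) \<in> parcs G \<longleftrightarrow> (\<phi> u, \<phi> v) \<in> parcs H))"
    (is "?L \<longleftrightarrow> ?R")
proof
  interpret G: pair_graph G by fact
  interpret H: pair_graph H by fact
  {
    assume ?L
    then obtain f where f: "pre_digraph.digraph_isomorphism (with_proj G) f"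
      and H: "with_proj H = app_iso f (with_proj G)" by (auto simp: digraph_iso_def)
    have V: "pverts H = iso_verts f ` pverts G" and A: "parcs H = iso_arcs f ` parcs G"
      and T: "iso_tail f = fst" "iso_head f = snd"
      using H by (simp_all add: app_iso_def with_proj_def)
    have inj: "inj_on (iso_verts f) (pverts G)"
      using f by (simp add: pre_digraph.digraph_isomorphism_def)
    have arc: "iso_arcs f (u, v) = (iso_verts f u, iso_verts f v)" if "(u, v) \<in> parcs G" for u v
      using f that T by (auto simp: pre_digraph.digraph_isomorphism_def prod_eq_iff)
    have "(u, v) \<in> parcs G \<longleftrightarrow> (iso_verts f u, iso_verts f v) \<in> parcs H"
      if uv: "u \<in> pverts G" "v \<in> pverts G" for u v
    proof
      assume "(u, v) \<in> parcs G"
      then show "(iso_verts f u, iso_verts f v) \<in> parcs H" using arc A by (metis imageI)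
    next
      assume "(iso_verts f u, iso_verts f v) \<in> parcs H"
      then obtain x y where xy: "(x, y) \<in> parcs G"
        and "iso_arcs f (x, y) = (iso_verts f u, iso_verts f v)" using A by fastforce
      then have "iso_verts f x = iso_verts f u" "iso_verts f y = iso_verts f v" using arc by auto
      then have "x = u" "y = v" using inj uv G.wellformed'[OF xy] by (auto dest: inj_onD)
      with xy show "(u, v) \<in> parcs G" by simp
    qed
    with inj V show ?R by (auto simp: bij_betw_def)
  }
  {
    assume ?R
    then obtain \<phi> where \<phi>: "bij_betw \<phi> (pverts G) (pverts H)"
      and adj: "\<And>u v. u \<in> pverts G \<Longrightarrow> v \<in> pverts G \<Longrightarrow>
        (u, v) \<in> parcs G \<longleftrightarrow> (\<phi> u, \<phi> v) \<in> parcs H" by auto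
    let ?f = "\<lparr> iso_verts = \<phi>, iso_arcs = map_prod \<phi> \<phi>, iso_head = snd, iso_tail = fst \<rparr>"
    have inj: "inj_on \<phi> (pverts G)" and V: "pverts H = \<phi> ` pverts G"
      using \<phi> by (auto simp: bij_betw_def)
    have "inj_on (map_prod \<phi> \<phi>) (parcs G)"
      by (rule inj_on_subset[OF map_prod_inj_on[OF inj inj]]) (auto dest: G.wellformed')
    then have "pre_digraph.digraph_isomorphism (with_proj G) ?f"
      using inj G.wf_digraph_axioms by (simp add: pre_digraph.digraph_isomorphism_def)
    moreover have "parcs H = map_prod \<phi> \<phi> ` parcs G"
    proof (intro set_eqI iffI)
      fix e assume e: "e \<in> parcs H"
      then obtain u v where "u \<in> pverts G" "v \<in> pverts G" "e = (\<phi> u, \<phi> v)"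
        using H.wellformed' V by (cases e) blast
      with e adj have "(u, v) \<in> parcs G" by simp
      then show "e \<in> map_prod \<phi> \<phi> ` parcs G" unfolding \<open>e = _\<close> by (rule rev_image_eqI) simp
    next
      fix e assume "e \<in> map_prod \<phi> \<phi> ` parcs G"
      then obtain u v where "(u, v) \<in> parcs G" "e = (\<phi> u, \<phi> v)" by auto
      then show "e \<in> parcs H" using adj[of u v] G.wellformed'[of u v] by blast
    qed
    then have "with_proj H = app_iso ?f (with_proj G)"
      using V by (simp add: app_iso_def with_proj_def)
    ultimately show ?L by (auto simp: digraph_iso_def)
  }
qed

end

theory Submission
  imports Defs
begin

text \<open>
  Let \<open>f\<close> be bn-independent and let \<open>I\<^sub>v\<close> be the set of vertices at distance less than \<open>f v\<close> from
  the broadcasting vertex \<open>v\<close>. The sets \<open>I\<^sub>v\<close> are disjoint, since a vertex of \<open>I\<^sub>v\<close> hears nobody but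
  \<open>v\<close>; each meets the distance levels \<open>0, \<dots>, f v - 1\<close> of \<open>v\<close>, because \<open>f v\<close> is at most the
  eccentricity; and the nonempty level \<open>f v\<close> lies outside all of them. Hence the weight is at most
  \<open>n - 1\<close>, and equality forces a single vertex \<open>b\<close> outside and one vertex in each level. Then every
  \<open>I\<^sub>v \<union> {b}\<close> is a path ending in \<open>b\<close> and no edge joins two different \<open>I\<^sub>v\<close>, so the graph is a spider with
  head \<open>b\<close> and legs of lengths \<open>f v\<close>, which is a path if there are only one or two legs. Conversely,
  on a spider the broadcast giving every leaf the length of its leg has weight \<open>n - 1\<close>.
\<close>

section \<open>Spiders\<close>

fun leaf_broadcast :: "nat list \<Rightarrow> spider_vertex \<Rightarrow> nat" where
  "leaf_broadcast ns Head = 0"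
| "leaf_broadcast ns (Leg i j) = (if j = ns ! i then j else 0)"

text \<open>
  The distance from the end of leg \<open>i\<close>. Only the lower bound is needed, so it suffices that this
  function increases by at most 1 along an edge.
\<close>

fun leaf_dist :: "nat list \<Rightarrow> nat \<Rightarrow> spider_vertex \<Rightarrow> nat" where
  "leaf_dist ns i Head = ns ! i"
| "leaf_dist ns i (Leg k j) = (if k = i then ns ! i - j else ns ! i + j)"

lemma pverts_Sp: "pverts (Sp ns) = insert Head (\<Union>i<length ns. Leg i ` {1..ns ! i})"
  by (auto simp: Sp_def Let_def)

lemma Head_in_Sp: "Head \<in> pverts (Sp ns)"
  by (simp add: pverts_Sp)

lemma Leg_in_Sp: "Leg i j \<in> pverts (Sp ns) \<longleftrightarrow> i < length ns \<and> 1 \<le> j \<and> j \<le> ns ! i"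
  by (auto simp: Sp_def Let_def)

lemma Head_Leg_arc:
  "(Head, Leg i j) \<in> parcs (Sp ns) \<longleftrightarrow> i < length ns \<and> 1 \<le> ns ! i \<and> j = 1"
  by (auto simp: Sp_def Let_def)

lemma Leg_Leg_arc:
  assumes "Leg i j \<in> pverts (Sp ns)" "Leg k l \<in> pverts (Sp ns)"
  shows "(Leg i j, Leg k l) \<in> parcs (Sp ns) \<longleftrightarrow> i = k \<and> (j = Suc l \<or> l = Suc j)"
  using assms by (auto simp: Sp_def Let_def)

lemma leaf_dist_arc: "(s, t) \<in> parcs (Sp ns) \<Longrightarrow> leaf_dist ns i t \<le> Suc (leaf_dist ns i s)"
  by (auto simp: Sp_def Let_def)

lemma sum_Sp:
  "(\<Sum>s\<in>pverts (Sp ns). g s) = g Head + (\<Sum>i<length ns. \<Sum>j=1..ns ! i. g (Leg i j))"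
proof -
  have "(\<Sum>s\<in>(\<Union>i<length ns. Leg i ` {1..ns ! i}). g s) =
      (\<Sum>i<length ns. \<Sum>s\<in>Leg i ` {1..ns ! i}. g s)"
    by (rule sum.UNION_disjoint) auto
  also have "\<dots> = (\<Sum>i<length ns. \<Sum>j=1..ns ! i. g (Leg i j))"
    by (intro sum.cong refl, subst sum.reindex) (auto simp: inj_on_def)
  finally show ?thesis
    unfolding pverts_Sp by (subst sum.insert) auto
qed

lemma card_Sp: "card (pverts (Sp ns)) = Suc (\<Sum>i<length ns. ns ! i)"
  using sum_Sp[of "\<lambda>_. 1 :: nat" ns] by simp

lemma sum_leaf_broadcast:
  assumes "\<forall>n\<in>set ns. n \<ge> 1"
  shows "(\<Sum>s\<in>pverts (Sp ns). leaf_broadcast ns s) = (\<Sum>i<length ns. ns ! i)"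
  unfolding sum_Sp using assms by (auto intro!: sum.cong simp: Suc_le_eq)

section \<open>Graph distance\<close>

locale connected_graph = pair_graph G for G :: "'a pair_pre_digraph" +
  assumes conn: "connected (with_proj G)"
begin

abbreviation V :: "'a set" where "V \<equiv> pverts G"

abbreviation d :: "'a \<Rightarrow> 'a \<Rightarrow> nat" where "d \<equiv> gdist G"

lemma gdist_le: "awalk u p v \<Longrightarrow> d u v \<le> length p"
  unfolding gdist_def by (intro wellorder_Inf_le1) auto

lemma gdist_walk:
  assumes "u \<in> V" "v \<in> V"
  obtains p where "awalk u p v" "length p = d u v"
proof -
  have "strongly_connected (with_proj G)"
    by (rule symmetric_connected_imp_strongly_connected[OF sym_arcs conn])
  then have "u \<rightarrow>\<^sup>*\<^bsub>with_proj G\<^esub> v" using assms by (auto simp: strongly_connected_def)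
  then have "{length p |p. awalk u p v} \<noteq> {}" by (auto simp: reachable_awalk)
  then have "d u v \<in> {length p |p. awalk u p v}"
    unfolding gdist_def by (intro Inf_nat_def1) auto
  then show ?thesis using that by auto
qed

lemma gdist_self: "u \<in> V \<Longrightarrow> d u u = 0"
  using gdist_le[of u "[]" u] by (simp add: awalk_Nil_iff)

lemma gdist_eq_0: "u \<in> V \<Longrightarrow> v \<in> V \<Longrightarrow> d u v = 0 \<longleftrightarrow> u = v"
  by (metis gdist_self gdist_walk awalk_Nil_iff length_0_conv)

lemma length_rev_path: "length (rev_path p) = length p"
  by (induction p) auto

lemma gdist_sym:
  assumes "u \<in> V" "v \<in> V"
  shows "d u v = d v u"
proof -
  have "d x y \<le> d y x" if "x \<in> V" "y \<in> V" for x y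
    using gdist_walk[OF that(2,1)] awalk_rev_path' gdist_le length_rev_path by metis
  then show ?thesis using assms by (simp add: antisym)
qed

lemma gdist_arc:
  assumes "v \<in> V" "(x, y) \<in> parcs G"
  shows "d v y \<le> Suc (d v x)"
proof -
  have "x \<in> V" "y \<in> V" using assms(2) by (auto dest: wellformed')
  with assms obtain p where p: "awalk v p x" "length p = d v x" using gdist_walk by blast
  have "awalk x [(x, y)] y" using assms \<open>y \<in> V\<close> by (simp add: awalk_simps)
  with p(1) have "awalk v (p @ [(x, y)]) y" by (rule awalk_appendI)
  from gdist_le[OF this] p(2) show ?thesis by simp
qed

lemma arc_sym: "(x, y) \<in> parcs G \<Longrightarrow> (y, x) \<in> parcs G"
  by (rule arcs_symmetric)

text \<open>Cut the last arc off a shortest walk: what remains reaches \<open>y\<close> in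
  \<open>i\<close> steps, and fewer would contradict \<open>gdist_arc\<close>.\<close>

lemma gdist_pred:
  assumes "v \<in> V" "x \<in> V" "d v x = Suc i"
  obtains y where "(y, x) \<in> parcs G" "d v y = i"
proof -
  obtain p where p: "awalk v p x" "length p = d v x" using gdist_walk assms by blast
  then obtain q e where pq: "p = q @ [e]" using assms(3) by (cases p rule: rev_cases) auto
  with p have e: "awalk v q (fst e)" "e \<in> parcs G" "snd e = x"
    by (auto simp: awalk_simps)
  then have ex: "(fst e, x) \<in> parcs G" by auto
  have "d v (fst e) \<le> i" using gdist_le[OF e(1)] p(2) pq assms(3) by simp
  moreover have "Suc i \<le> Suc (d v (fst e))" using gdist_arc[OF assms(1) ex] assms(3) by simp
  ultimately show ?thesis using that ex by simp
qed

text \<open>Repeated use of \<open>gdist_pred\<close> descends from \<open>x\<close> towards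
  \<open>v\<close> one level at a time; \<open>k\<close> is the number of levels still to
  descend.\<close>

lemma gdist_level:
  assumes "v \<in> V" "x \<in> V" "i \<le> d v x"
  obtains y where "y \<in> V" "d v y = i"
proof -
  have "\<forall>x\<in>V. d v x = i + k \<longrightarrow> (\<exists>y\<in>V. d v y = i)" for k
  proof (induction k)
    case (Suc k)
    show ?case
    proof (intro ballI impI)
      fix x assume "x \<in> V" "d v x = i + Suc k"
      then obtain y where "(y, x) \<in> parcs G" "d v y = i + k"
        using gdist_pred[of v x "i + k"] assms(1) by auto
      then show "\<exists>y\<in>V. d v y = i" using Suc by (auto dest: wellformed')
    qed
  qed auto
  then show ?thesis using that assms by (metis le_add_diff_inverse)
qed

text \<open>Along a shortest walk from \<open>v\<close>, \<open>h\<close> starts at 0 and gains at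
  most 1 per arc. An explicit potential thus bounds distances from below.\<close>

lemma lipschitz_le_gdist:
  fixes h :: "'a \<Rightarrow> nat"
  assumes "h v = 0" "\<And>x y. (x, y) \<in> parcs G \<Longrightarrow> h y \<le> Suc (h x)"
    and "v \<in> V" "x \<in> V"
  shows "h x \<le> d v x"
  using assms(4)
proof (induction "d v x" arbitrary: x)
  case 0
  then show ?case using gdist_eq_0[of v x] assms by simp
next
  case (Suc i)
  then obtain y where y: "(y, x) \<in> parcs G" "d v y = i"
    using gdist_pred[of v x i] assms(3) by metis
  then show ?case using Suc(1)[of y] Suc(2) assms(2)[OF y(1)] by (auto dest: wellformed')
qed

lemma gdist_le_ecc: "v \<in> V \<Longrightarrow> x \<in> V \<Longrightarrow> d v x \<le> ecc G v"
  unfolding ecc_def by (intro Max_ge) auto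

lemma ecc_attained:
  assumes "v \<in> V"
  obtains x where "x \<in> V" "d v x = ecc G v"
proof -
  have "ecc G v \<in> d v ` V" unfolding ecc_def using assms by (intro Max_in) auto
  then show ?thesis using that by auto
qed

lemma ecc_le_diam: "v \<in> V \<Longrightarrow> ecc G v \<le> diam G"
  unfolding diam_def by (intro Max_ge) auto

end

section \<open>Interiors of broadcast balls\<close>

locale bn_broadcast = connected_graph G for G :: "'a pair_pre_digraph" +
  fixes f :: "'a \<Rightarrow> nat"
  assumes broadcast: "broadcast G f" and bn: "bn_independent G f"
begin

abbreviation S :: "'a set" where "S \<equiv> broadcasting G f"

text \<open>The set \<open>I\<^sub>v\<close> of the overview. The inequality is strict because
  bn-independence lets balls overlap on their boundaries.\<close>

definition interior :: "'a \<Rightarrow> 'a set" where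
  "interior v = {x \<in> V. d v x < f v}"

definition outside :: "'a set" where
  "outside = V - (\<Union>v\<in>S. interior v)"

lemma S_V: "v \<in> S \<Longrightarrow> v \<in> V" and S_pos: "v \<in> S \<Longrightarrow> 0 < f v"
  by (auto simp: broadcasting_def)

lemma finite_S: "finite S"
  by (simp add: broadcasting_def)

text \<open>If \<open>x\<close> heard \<open>w\<close> too, it would hear at least two broadcasters,
  and bn-independence would put it at distance at least \<open>f v\<close> from \<open>v\<close>,
  outside the interior.\<close>

lemma not_hears_two:
  assumes "v \<in> S" "w \<in> S" "v \<noteq> w" "x \<in> interior v"
  shows "f w < d w x"
proof (rule ccontr)
  assume "\<not> f w < d w x"
  then have "{v, w} \<subseteq> {v. hears G f x v}"
    using assms by (auto simp: hears_def interior_def gdist_sym S_V)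
  \<comment> \<open>Monotonicity of \<open>card\<close> requires this, since an infinite set has
    \<open>card\<close> 0.\<close>
  moreover have "finite {v. hears G f x v}"
    by (rule finite_subset[OF _ finite_S]) (auto simp: hears_def)
  ultimately have "card {v, w} \<le> card {v. hears G f x v}" by (rule card_mono[rotated])
  then have "f v \<le> d x v" using bn assms by (auto simp: bn_independent_def interior_def)
  then show False using assms by (simp add: interior_def gdist_sym S_V)
qed

lemma interior_disjoint: "v \<in> S \<Longrightarrow> w \<in> S \<Longrightarrow> x \<in> interior v \<Longrightarrow> x \<in> interior w \<Longrightarrow> v = w"
  using not_hears_two[of v w x] by (auto simp: interior_def)

text \<open>Some vertex lies at distance \<open>ecc G v\<close>, which is at least
  \<open>f v\<close>, and every smaller distance is met on the way to it.\<close>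

lemma level_nonempty:
  assumes "v \<in> S" "i \<le> f v"
  obtains x where "x \<in> V" "d v x = i"
proof -
  have "i \<le> ecc G v" using assms broadcast S_V by (auto simp: broadcast_def intro: le_trans)
  moreover obtain x where "x \<in> V" "d v x = ecc G v" using ecc_attained[OF S_V[OF assms(1)]] .
  ultimately show ?thesis using that gdist_level[OF S_V[OF assms(1)]] by metis
qed

text \<open>The vertex is too far from \<open>v\<close> for the interior of \<open>v\<close>, and it
  hears \<open>v\<close>, which no vertex in another interior does.\<close>

lemma boundary_outside:
  assumes "v \<in> S" "x \<in> V" "d v x = f v"
  shows "x \<in> outside"
  using assms not_hears_two[of _ v x] by (fastforce simp: outside_def interior_def)

lemma boundary_nonempty:
  assumes "v \<in> S"
  obtains x where "x \<in> outside" "d v x = f v"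
proof -
  obtain x where "x \<in> V" "d v x = f v" by (rule level_nonempty[OF assms order_refl])
  then show ?thesis using that boundary_outside[OF assms] by blast
qed

lemma interior_levels: "v \<in> S \<Longrightarrow> d v ` interior v = {..<f v}"
proof (intro equalityI subsetI)
  fix i assume v: "v \<in> S" and i: "i \<in> {..<f v}"
  then obtain x where "x \<in> V" "d v x = i" using level_nonempty[OF v] less_imp_le by blast
  with i show "i \<in> d v ` interior v" by (intro rev_image_eqI[of x]) (auto simp: interior_def)
qed (auto simp: interior_def)

lemma finite_interior: "finite (interior v)"
  by (simp add: interior_def)

lemma card_interior: "v \<in> S \<Longrightarrow> f v \<le> card (interior v)"
  using card_image_le[OF finite_interior, of "d v" v] by (simp add: interior_levels)

lemma card_V: "card V = card outside + (\<Sum>v\<in>S. card (interior v))"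
proof -
  have "card (\<Union>v\<in>S. interior v) = (\<Sum>v\<in>S. card (interior v))"
    using finite_S finite_interior interior_disjoint by (intro card_UN_disjoint) blast+
  moreover have "card V = card outside + card (\<Union>v\<in>S. interior v)"
    unfolding outside_def
    by (subst card_Diff_subset) (auto simp: interior_def finite_S intro!: le_add_diff_inverse2[symmetric] card_mono)
  ultimately show ?thesis by simp
qed

lemma weight_S: "weight G f = (\<Sum>v\<in>S. f v)"
  unfolding weight_def by (rule sum.mono_neutral_right) (auto simp: broadcasting_def)

lemma outside_pos:
  assumes "S \<noteq> {}"
  shows "0 < card outside"
proof -
  obtain v where "v \<in> S" using assms by blast
  then obtain x where "x \<in> outside" by (rule boundary_nonempty)
  then show ?thesis by (auto simp: card_gt_0_iff outside_def)
qed

text \<open>The interiors have at least \<open>f v\<close> vertices each and are disjoint; the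
  vertex lost is one in \<open>outside\<close>. It exists only if somebody broadcasts, so the zero
  broadcast is treated apart.\<close>

lemma weight_le: "weight G f \<le> card V - 1"
proof (cases "S = {}")
  case False
  then show ?thesis
    using outside_pos card_V weight_S sum_mono[of S f "\<lambda>v. card (interior v)"] card_interior
    by fastforce
qed (simp add: weight_S)

section \<open>Broadcasts of maximum weight\<close>

lemma extremal_imp_Sp:
  assumes wt: "weight G f = card V - 1" and two: "2 \<le> card V"
  shows "\<exists>ns. ns \<noteq> [] \<and> (\<forall>n\<in>set ns. n \<ge> 1) \<and> digraph_iso (with_proj G) (with_proj (Sp ns))"
proof -
  \<comment> \<open>Without broadcasters the weight would be 0, but it is at least 1.\<close>
  have Sne: "S \<noteq> {}" using wt two by (auto simp: weight_S)
  have le: "(\<Sum>v\<in>S. f v) \<le> (\<Sum>v\<in>S. card (interior v))" by (rule sum_mono) (rule card_interior)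
  \<comment> \<open>Both estimates behind \<open>weight_le\<close> must be tight:
    \<open>card V\<close> is at least 1 plus the sum of the \<open>f v\<close>, which is
    \<open>card V\<close> again.\<close>
  have "card outside = 1" and sum_eq: "(\<Sum>v\<in>S. f v) = (\<Sum>v\<in>S. card (interior v))"
    using le outside_pos[OF Sne] card_V wt two unfolding weight_S by linarith+
  then obtain b where b: "outside = {b}" by (auto simp: card_1_singleton_iff)
  then have bV: "b \<in> V" by (auto simp: outside_def)
  have card_eq: "card (interior v) = f v" if "v \<in> S" for v
    using sum_mono_inv[OF sum_eq card_interior that finite_S] by simp
  \<comment> \<open>The interior has \<open>f v\<close> vertices and fills \<open>f v\<close>
    levels, so each level below \<open>f v\<close> holds exactly one vertex.\<close>
  have inj: "inj_on (d v) (interior v)" if "v \<in> S" for v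
    using that card_eq interior_levels by (intro eq_card_imp_inj_on finite_interior) simp
  have db: "d v b = f v" if "v \<in> S" for v using boundary_nonempty[OF that] b by (metis singletonD)
  have b_int: "b \<notin> interior v" if "v \<in> S" for v using db[OF that] by (simp add: interior_def)

  \<comment> \<open>An enumeration of the broadcasters numbers the legs; \<open>ix x\<close> will be
    the number of the leg containing \<open>x\<close>.\<close>
  obtain vs where vs: "set vs = S" "distinct vs" using finite_distinct_list[OF finite_S] by auto
  let ?ns = "map f vs"
  have vsS: "vs ! i \<in> S" if "i < length vs" for i using nth_mem[OF that] vs(1) by simp
  have "\<exists>i<length vs. x \<in> interior (vs ! i)" if x: "x \<in> V" "x \<noteq> b" for x
  proof -
    have "x \<notin> outside" using b x by simp
    then obtain v where "v \<in> set vs" "x \<in> interior v" using x vs(1) by (auto simp: outside_def)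
    then show ?thesis unfolding in_set_conv_nth by blast
  qed
  then obtain ix where ix: "\<And>x. x \<in> V \<Longrightarrow> x \<noteq> b \<Longrightarrow> ix x < length vs \<and> x \<in> interior (vs ! ix x)"
    by metis
  have ix_eq: "ix x = i" if "i < length vs" "x \<in> interior (vs ! i)" for x i
  proof -
    have "x \<in> V" "x \<noteq> b" using that b_int vsS by (auto simp: interior_def)
    then show ?thesis using ix that interior_disjoint vsS vs(2) nth_eq_iff_index_eq by metis
  qed
  \<comment> \<open>Distances in \<open>G\<close> are measured from the leaf \<open>v\<close>,
    positions on a leg from the head. As \<open>d v b = f v\<close>, level \<open>d v x\<close>
    becomes position \<open>f v - d v x\<close>, and \<open>v\<close> itself the end of the
    leg.\<close>
  define \<phi> where "\<phi> x = (if x = b then Head else Leg (ix x) (f (vs ! ix x) - d (vs ! ix x) x))" for x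
  have \<phi>V: "\<phi> x \<in> pverts (Sp ?ns)" if "x \<in> V" for x
  proof (cases "x = b")
    case False
    then show ?thesis using ix[OF that False] by (auto simp: \<phi>_def Leg_in_Sp interior_def)
  qed (simp add: \<phi>_def Head_in_Sp)
  have "inj_on \<phi> V"
  proof (rule inj_onI)
    fix x y assume xy: "x \<in> V" "y \<in> V" "\<phi> x = \<phi> y"
    show "x = y"
    proof (cases "x = b \<or> y = b")
      case False
      define v where "v = vs ! ix x"
      have "ix x = ix y" and v: "f v - d v x = f v - d v y"
        using False xy by (auto simp: \<phi>_def v_def)
      then have i: "v \<in> S" "x \<in> interior v" "y \<in> interior v"
        using ix[of x] ix[of y] False xy vsS by (auto simp: v_def)
      with v have "d v x = d v y" by (auto simp: interior_def)
      then show ?thesis using inj[OF i(1)] i by (auto dest: inj_onD)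
    qed (use xy in \<open>auto simp: \<phi>_def split: if_splits\<close>)
  qed
  moreover have "\<phi> ` V = pverts (Sp ?ns)"
  proof (intro equalityI subsetI)
    fix s assume "s \<in> \<phi> ` V"
    then obtain x where "x \<in> V" "s = \<phi> x" by blast
    then show "s \<in> pverts (Sp ?ns)" using \<phi>V by simp
  next
    fix s assume s: "s \<in> pverts (Sp ?ns)"
    show "s \<in> \<phi> ` V"
    proof (cases s)
      case Head
      then show ?thesis using bV by (intro rev_image_eqI[of b]) (simp_all add: \<phi>_def)
    next
      case (Leg i j)
      define v where "v = vs ! i"
      have ij: "i < length vs" "1 \<le> j" "j \<le> f v" using s Leg by (auto simp: Leg_in_Sp v_def)
      then have v: "v \<in> S" using vsS v_def by simp
      \<comment> \<open>Position \<open>j\<close> is level \<open>f v - j\<close>, which is below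
        \<open>f v\<close> because positions start at 1.\<close>
      then have "f v - j \<in> d v ` interior v" using ij interior_levels[OF v] by auto
      then obtain x where x: "x \<in> interior v" "d v x = f v - j" by auto
      have "ix x = i" using ix_eq x(1) ij v_def by simp
      moreover have "x \<noteq> b" using x(1) b_int v by blast
      ultimately have "\<phi> x = s" using x ij Leg by (simp add: \<phi>_def flip: v_def)
      moreover have "x \<in> V" using x(1) by (simp add: interior_def)
      ultimately show ?thesis by blast
    qed
  qed
  moreover have "(x, y) \<in> parcs G \<longleftrightarrow> (\<phi> x, \<phi> y) \<in> parcs (Sp ?ns)" if "x \<in> V" "y \<in> V" for x y
  proof -
    interpret Sp: pair_graph "Sp ?ns" by (rule pair_graph_Sp)
    have head: "(b, y) \<in> parcs G \<longleftrightarrow> (Head, \<phi> y) \<in> parcs (Sp ?ns)" if y: "y \<in> V" "y \<noteq> b" for y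
    proof -
      define v where "v = vs ! ix y"
      have v: "v \<in> S" "y \<in> interior v" "ix y < length vs" using ix[OF y] vsS by (auto simp: v_def)
      \<comment> \<open>The only possible neighbour of \<open>b\<close> in this interior is its
        single vertex on the last level \<open>f v - 1\<close>; it is adjacent to \<open>b\<close>,
        being the predecessor of \<open>b\<close> on a shortest walk from \<open>v\<close>.\<close>
      have "(b, y) \<in> parcs G \<longleftrightarrow> f v - d v y = 1"
      proof
        assume "(b, y) \<in> parcs G"
        then have "f v \<le> Suc (d v y)" using gdist_arc[OF S_V[OF v(1)] arc_sym] db[OF v(1)] by metis
        then show "f v - d v y = 1" using v(2) by (auto simp: interior_def)
      next
        assume "f v - d v y = 1"
        then have "d v b = Suc (d v y)" using db[OF v(1)] v(2) by (simp add: interior_def)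
        then obtain z where z: "(z, b) \<in> parcs G" "d v z = d v y"
          using gdist_pred[OF S_V[OF v(1)] bV] by metis
        then have "z \<in> interior v" using v(2) by (auto simp: interior_def dest: wellformed')
        then have "z = y" using inj[OF v(1)] z(2) v(2) by (auto dest: inj_onD)
        then show "(b, y) \<in> parcs G" using z(1) arc_sym by simp
      qed
      then show ?thesis using y v S_pos[OF v(1)] by (simp add: \<phi>_def Head_Leg_arc flip: v_def)
    qed
    have leg: "(x, y) \<in> parcs G \<longleftrightarrow> (\<phi> x, \<phi> y) \<in> parcs (Sp ?ns)"
      if xy: "x \<in> V" "y \<in> V" "x \<noteq> b" "y \<noteq> b" for x y
    proof -
      define v w where "v = vs ! ix x" and "w = vs ! ix y"
      have v: "v \<in> S" "x \<in> interior v" "ix x < length vs"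
        and w: "w \<in> S" "y \<in> interior w" "ix y < length vs"
        using ix xy vsS by (auto simp: v_def w_def)
      show ?thesis
      proof (cases "ix x = ix y")
        case True
        then have wv: "w = v" by (simp add: v_def w_def)
        \<comment> \<open>A shortest walk from \<open>v\<close> to \<open>t\<close> passes the level
          of \<open>s\<close> just before \<open>t\<close>, and \<open>s\<close> is the only
          interior vertex there.\<close>
        have step: "(s, t) \<in> parcs G" if st: "s \<in> interior v" "t \<in> interior v" "d v t = Suc (d v s)" for s t
        proof -
          obtain z where z: "(z, t) \<in> parcs G" "d v z = d v s"
            using gdist_pred[OF S_V[OF v(1)] _ st(3)] st(2) by (auto simp: interior_def)
          then have "z \<in> interior v" using st by (auto simp: interior_def dest: wellformed')
          then have "z = s" using inj[OF v(1)] z(2) st by (auto dest: inj_onD)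
          then show ?thesis using z(1) by simp
        qed
        have "(x, y) \<in> parcs G \<longleftrightarrow> d v x = Suc (d v y) \<or> d v y = Suc (d v x)"
        proof
          \<comment> \<open>Levels of adjacent vertices differ by at most 1, and distinct interior
            vertices never share a level.\<close>
          assume a: "(x, y) \<in> parcs G"
          then have "x \<noteq> y" using no_loops by fastforce
          then have "d v x \<noteq> d v y" using inj[OF v(1)] v w wv by (auto dest: inj_onD)
          then show "d v x = Suc (d v y) \<or> d v y = Suc (d v x)"
            using gdist_arc[OF S_V[OF v(1)] a] gdist_arc[OF S_V[OF v(1)] arc_sym[OF a]] by linarith
        next
          assume "d v x = Suc (d v y) \<or> d v y = Suc (d v x)"
          then show "(x, y) \<in> parcs G" using step arc_sym v w wv by metis
        qed
        also have "\<dots> \<longleftrightarrow> f v - d v y = Suc (f v - d v x) \<or> f v - d v x = Suc (f v - d v y)"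
          using v(2) w(2) wv by (auto simp: interior_def)
        also have "\<dots> \<longleftrightarrow> (\<phi> x, \<phi> y) \<in> parcs (Sp ?ns)"
          using xy \<phi>V[OF xy(1)] \<phi>V[OF xy(2)] wv True
          by (auto simp: \<phi>_def Leg_Leg_arc simp flip: v_def w_def)
        finally show ?thesis .
      next
        case False
        then have "v \<noteq> w" using v w vs(2) by (simp add: v_def w_def nth_eq_iff_index_eq)
        \<comment> \<open>An arc leaving the interior of \<open>v\<close> ends within distance
          \<open>f v\<close> of \<open>v\<close>, so \<open>y\<close> would hear \<open>v\<close>
          although it lies in the interior of \<open>w\<close>.\<close>
        have "(x, y) \<notin> parcs G"
        proof
          assume "(x, y) \<in> parcs G"
          then have "d v y \<le> f v" using gdist_arc[OF S_V[OF v(1)]] v(2) by (fastforce simp: interior_def)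
          then show False using not_hears_two[of w v y] v w \<open>v \<noteq> w\<close> by auto
        qed
        moreover have "(\<phi> x, \<phi> y) \<notin> parcs (Sp ?ns)"
          using xy False \<phi>V[OF xy(1)] \<phi>V[OF xy(2)] by (simp add: \<phi>_def Leg_Leg_arc)
        ultimately show ?thesis by simp
      qed
    qed
    have "\<phi> b = Head" by (simp add: \<phi>_def)
    moreover have "(b, b) \<notin> parcs G" using no_loops by fastforce
    moreover have "(Head, Head) \<notin> parcs (Sp ?ns)" by (auto simp: Sp_def Let_def)
    moreover have "(x, y) \<in> parcs G \<longleftrightarrow> (y, x) \<in> parcs G" using arc_sym by blast
    moreover have "(\<phi> x, \<phi> y) \<in> parcs (Sp ?ns) \<longleftrightarrow> (\<phi> y, \<phi> x) \<in> parcs (Sp ?ns)"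
      using Sp.arcs_symmetric by blast
    ultimately show ?thesis using head leg that by metis
  qed
  ultimately have "digraph_iso (with_proj G) (with_proj (Sp ?ns))"
    unfolding digraph_iso_pair_iff[OF pair_graph_axioms pair_graph_Sp]
    by (auto simp: bij_betw_def)
  moreover have "?ns \<noteq> []" using Sne vs(1) by auto
  moreover have "\<forall>n\<in>set ?ns. n \<ge> 1" using vs(1) S_pos by (auto simp: Suc_leI)
  ultimately show ?thesis by blast
qed

end

section \<open>The leaf broadcast on a spider\<close>

context connected_graph
begin

text \<open>The leaf broadcast, pulled back along the isomorphism, gives the lower bound;
  \<open>weight_le\<close> applied to a broadcast of maximum weight gives the upper one.\<close>

lemma Sp_imp_alpha_bn:
  assumes pos: "\<forall>n\<in>set ns. n \<ge> 1"
    and iso: "digraph_iso (with_proj G) (with_proj (Sp ns))"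
  shows "alpha_bn G = card V - 1"
proof -
  obtain \<phi> where \<phi>: "bij_betw \<phi> V (pverts (Sp ns))"
    and adj: "\<And>u v. u \<in> V \<Longrightarrow> v \<in> V \<Longrightarrow> (u, v) \<in> parcs G \<longleftrightarrow> (\<phi> u, \<phi> v) \<in> parcs (Sp ns)"
    using iso unfolding digraph_iso_pair_iff[OF pair_graph_axioms pair_graph_Sp] by auto
  define f where "f x = leaf_broadcast ns (\<phi> x)" for x
  \<comment> \<open>\<open>leaf_dist\<close> vanishes at the end of leg \<open>i\<close> and grows
    by at most 1 along arcs, which \<phi> preserves.\<close>
  have lower: "leaf_dist ns i (\<phi> x) \<le> d v x"
    if "v \<in> V" "\<phi> v = Leg i (ns ! i)" "x \<in> V" for i v x
  proof (rule lipschitz_le_gdist[of "\<lambda>x. leaf_dist ns i (\<phi> x)"])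
    show "leaf_dist ns i (\<phi> y) \<le> Suc (leaf_dist ns i (\<phi> x))" if "(x, y) \<in> parcs G" for x y
      using leaf_dist_arc adj wellformed'[OF that] that by metis
  qed (use that in auto)
  have S: "\<exists>i<length ns. \<phi> v = Leg i (ns ! i) \<and> f v = ns ! i" if "v \<in> V" "f v > 0" for v
  proof -
    have "\<phi> v \<in> pverts (Sp ns)" using \<phi> that(1) by (auto simp: bij_betw_def)
    then show ?thesis using that(2) by (cases "\<phi> v") (auto simp: f_def Sp_def Let_def split: if_splits)
  qed
  have "Head \<in> \<phi> ` V" using \<phi> by (simp add: bij_betw_def pverts_Sp)
  then obtain b where b: "b \<in> V" "\<phi> b = Head" by auto
  \<comment> \<open>The head is far enough from the leaf to witness the eccentricity bound.\<close>
  have "f v \<le> ecc G v" if v: "v \<in> V" for v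
  proof (cases "f v > 0")
    case True
    then obtain i where "\<phi> v = Leg i (ns ! i)" "f v = ns ! i" using S v by blast
    then have "f v \<le> d v b" using lower[OF v _ b(1)] b(2) by simp
    then show ?thesis using gdist_le_ecc[OF v b(1)] by simp
  qed simp
  then have bc: "broadcast G f" using ecc_le_diam by (fastforce simp: broadcast_def)
  have bn: "bn_independent G f"
    unfolding bn_independent_def
  proof (intro ballI impI)
    fix x u assume x: "x \<in> V" and two: "1 < card {v. hears G f x v}" and u: "u \<in> broadcasting G f"
    obtain v w where vw: "v \<noteq> w" "hears G f x v" "hears G f x w"
      using two card_le_Suc0_iff_eq[of "{v. hears G f x v}"] card.infinite[of "{v. hears G f x v}"]
      by fastforce
    then have V: "v \<in> V" "w \<in> V" "f v > 0" "f w > 0" "d v x \<le> f v" "d w x \<le> f w"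
      using x by (auto simp: hears_def broadcasting_def gdist_sym)
    obtain i k where i: "\<phi> v = Leg i (ns ! i)" "f v = ns ! i" and k: "\<phi> w = Leg k (ns ! k)" "f w = ns ! k"
      using S V by metis
    have "i \<noteq> k" using vw(1) i k V \<phi> by (metis bij_betw_def inj_onD)
    moreover have "leaf_dist ns i (\<phi> x) \<le> ns ! i" "leaf_dist ns k (\<phi> x) \<le> ns ! k"
      using lower[OF V(1) i(1) x] lower[OF V(2) k(1) x] V i k by auto
    moreover have "\<phi> x \<in> pverts (Sp ns)" using \<phi> x by (auto simp: bij_betw_def)
    \<comment> \<open>A vertex other than the head within \<open>ns ! i\<close> of the end of leg
      \<open>i\<close> lies on leg \<open>i\<close>; nothing but the head is that close to the ends
      of two different legs.\<close>
    ultimately have "\<phi> x = Head" by (cases "\<phi> x") (auto simp: Sp_def Let_def split: if_splits)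
    moreover have "u \<in> V" "f u > 0" using u by (auto simp: broadcasting_def)
    \<comment> \<open>The head is at least a full leg length away from every leaf.\<close>
    ultimately show "f u \<le> d x u" using S[of u] lower[of u _ x] x gdist_sym[of x u] by auto
  qed
  have "weight G f = (\<Sum>s\<in>pverts (Sp ns). leaf_broadcast ns s)"
    unfolding weight_def f_def using sum.reindex_bij_betw[OF \<phi>] .
  also have "\<dots> = card V - 1"
    using sum_leaf_broadcast[OF pos] card_Sp[of ns] bij_betw_same_card[OF \<phi>] by simp
  finally have "card V - 1 \<le> alpha_bn G" using alpha_bn_attained(2)[OF _ bc bn] by simp
  moreover obtain g where "broadcast G g" "bn_independent G g" "weight G g = alpha_bn G"
    using alpha_bn_attained(1)[of G] by auto
  then have "alpha_bn G \<le> card V - 1"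
    using bn_broadcast.weight_le[of G g]
    by (simp add: bn_broadcast_def bn_broadcast_axioms_def connected_graph_axioms)
  ultimately show ?thesis by simp
qed

lemma alpha_bn_iff_Sp:
  assumes "2 \<le> card V"
  shows "alpha_bn G = card V - 1 \<longleftrightarrow>
    (\<exists>ns. ns \<noteq> [] \<and> (\<forall>n\<in>set ns. n \<ge> 1) \<and> digraph_iso (with_proj G) (with_proj (Sp ns)))"
proof
  assume "alpha_bn G = card V - 1"
  moreover obtain g where "broadcast G g" "bn_independent G g" "weight G g = alpha_bn G"
    using alpha_bn_attained(1)[of G] by auto
  ultimately show "\<exists>ns. ns \<noteq> [] \<and> (\<forall>n\<in>set ns. n \<ge> 1) \<and>
      digraph_iso (with_proj G) (with_proj (Sp ns))"
    using bn_broadcast.extremal_imp_Sp[of G g] assms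
    by (simp add: bn_broadcast_def bn_broadcast_axioms_def connected_graph_axioms)
qed (use Sp_imp_alpha_bn in blast)

end

section \<open>Paths as spiders with one or two legs\<close>

lemma digraph_iso_pair_trans:
  assumes "pair_graph G" "pair_graph H" "pair_graph K"
    and "digraph_iso (with_proj G) (with_proj H)" "digraph_iso (with_proj H) (with_proj K)"
  shows "digraph_iso (with_proj G) (with_proj K)"
proof -
  obtain \<phi> \<psi> where "bij_betw \<phi> (pverts G) (pverts H)" "bij_betw \<psi> (pverts H) (pverts K)"
    and "\<forall>u\<in>pverts G. \<forall>v\<in>pverts G. (u, v) \<in> parcs G \<longleftrightarrow> (\<phi> u, \<phi> v) \<in> parcs H"
    and "\<forall>u\<in>pverts H. \<forall>v\<in>pverts H. (u, v) \<in> parcs H \<longleftrightarrow> (\<psi> u, \<psi> v) \<in> parcs K"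
    using assms(4,5) unfolding digraph_iso_pair_iff[OF assms(1,2)] digraph_iso_pair_iff[OF assms(2,3)]
    by blast
  then show ?thesis
    unfolding digraph_iso_pair_iff[OF assms(1,3)]
    by (intro exI[of _ "\<psi> \<circ> \<phi>"] conjI bij_betw_trans) (auto dest: bij_betwE)
qed

lemma digraph_iso_pair_sym:
  assumes "pair_graph G" "pair_graph H" "digraph_iso (with_proj G) (with_proj H)"
  shows "digraph_iso (with_proj H) (with_proj G)"
proof -
  obtain \<phi> where \<phi>: "bij_betw \<phi> (pverts G) (pverts H)"
    and adj: "\<forall>u\<in>pverts G. \<forall>v\<in>pverts G. (u, v) \<in> parcs G \<longleftrightarrow> (\<phi> u, \<phi> v) \<in> parcs H"
    using assms(3) unfolding digraph_iso_pair_iff[OF assms(1,2)] by blast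
  let ?\<psi> = "inv_into (pverts G) \<phi>"
  have \<psi>: "bij_betw ?\<psi> (pverts H) (pverts G)" using \<phi> by (rule bij_betw_inv_into)
  have "(u, v) \<in> parcs H \<longleftrightarrow> (?\<psi> u, ?\<psi> v) \<in> parcs G" if "u \<in> pverts H" "v \<in> pverts H" for u v
    using adj that bij_betwE[OF \<psi>] bij_betw_inv_into_right[OF \<phi>] by metis
  then show ?thesis using \<psi> unfolding digraph_iso_pair_iff[OF assms(2,1)] by blast
qed

text \<open>Both legs are unrolled into one line with the head at \<open>a\<close>: leg 0 runs down
  to 0, the other leg upwards.\<close>

fun path_position :: "nat \<Rightarrow> spider_vertex \<Rightarrow> nat" where
  "path_position a Head = a"
| "path_position a (Leg i j) = (if i = 0 then a - j else a + j)"

lemma Sp_two_legs_iso_path: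
  "digraph_iso (with_proj (Sp [a, b])) (with_proj (path_graph (Suc (a + b))))"
proof -
  let ?V = "pverts (Sp [a, b])"
  have V: "s \<in> ?V \<longleftrightarrow> (case s of Head \<Rightarrow> True
      | Leg i j \<Rightarrow> 1 \<le> j \<and> (i = 0 \<and> j \<le> a \<or> i = 1 \<and> j \<le> b))" for s
    by (cases s) (auto simp: Sp_def Let_def less_Suc_eq)
  have "inj_on (path_position a) ?V"
  proof (rule inj_onI)
    fix s t assume "s \<in> ?V" "t \<in> ?V" "path_position a s = path_position a t"
    then show "s = t" unfolding V by (cases s; cases t) (auto split: if_splits)
  qed
  moreover have "path_position a ` ?V = {..<Suc (a + b)}"
  proof (intro equalityI subsetI)
    fix k assume "k \<in> path_position a ` ?V"
    then obtain s where "s \<in> ?V" "k = path_position a s" by auto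
    then show "k \<in> {..<Suc (a + b)}" unfolding V by (cases s) auto
  next
    fix k assume k: "k \<in> {..<Suc (a + b)}"
    consider "k < a" | "k = a" | "a < k" by linarith
    then show "k \<in> path_position a ` ?V"
    proof cases
      case 1
      then show ?thesis by (intro rev_image_eqI[of "Leg 0 (a - k)"]) (auto simp: V)
    next
      case 2
      then show ?thesis by (intro rev_image_eqI[of Head]) (auto simp: V)
    next
      case 3
      then show ?thesis using k by (intro rev_image_eqI[of "Leg 1 (k - a)"]) (auto simp: V)
    qed
  qed
  moreover have "(s, t) \<in> parcs (Sp [a, b]) \<longleftrightarrow>
      (path_position a s, path_position a t) \<in> parcs (path_graph (Suc (a + b)))"
    if "s \<in> ?V" "t \<in> ?V" for s t
    using that unfolding V
    by (cases s; cases t) (auto simp: Sp_def path_graph_def Let_def)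
  ultimately show ?thesis
    unfolding digraph_iso_pair_iff[OF pair_graph_Sp pair_graph_path_graph]
    by (intro exI[of _ "path_position a"]) (auto simp: bij_betw_def path_graph_def Let_def)
qed

text \<open>A leg of length 0 contributes neither vertices nor arcs, so one leg is the case
  \<open>b = 0\<close> of two.\<close>

lemma Sp_one_leg_iso_path: "digraph_iso (with_proj (Sp [a])) (with_proj (path_graph (Suc a)))"
proof -
  have "Sp [a] = Sp [a, 0]"
    by (auto simp: Sp_def Let_def less_Suc_eq)
  then show ?thesis using Sp_two_legs_iso_path[of a 0] by simp
qed

text \<open>The number of legs decides: one or two legs form a path, three or more a spider.
  Conversely, a path is a single leg whose head is an end vertex.\<close>

lemma path_or_spider_iff_Sp:
  assumes G: "pair_graph G" and two: "2 \<le> card (pverts G)"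
  shows "is_path G \<or> is_spider G \<longleftrightarrow>
    (\<exists>ns. ns \<noteq> [] \<and> (\<forall>n\<in>set ns. n \<ge> 1) \<and> digraph_iso (with_proj G) (with_proj (Sp ns)))"
    (is "_ \<longleftrightarrow> ?R")
proof
  assume "is_path G \<or> is_spider G"
  then show ?R
  proof
    assume "is_path G"
    then obtain m where m: "digraph_iso (with_proj G) (with_proj (path_graph m))"
      by (auto simp: is_path_def)
    then obtain \<phi> where "bij_betw \<phi> (pverts G) (pverts (path_graph m))"
      unfolding digraph_iso_pair_iff[OF G pair_graph_path_graph] by blast
    then have "card (pverts G) = m" by (simp add: bij_betw_same_card path_graph_def Let_def)
    \<comment> \<open>The single leg has \<open>m - 1\<close> edges; having at least two vertices
      makes this length positive.\<close>
    with two have "Suc (m - 1) = m" "1 \<le> m - 1" by auto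
    then have "digraph_iso (with_proj G) (with_proj (Sp [m - 1]))"
      using digraph_iso_pair_trans[OF G pair_graph_path_graph pair_graph_Sp m]
        digraph_iso_pair_sym[OF pair_graph_Sp pair_graph_path_graph Sp_one_leg_iso_path[of "m - 1"]]
      by simp
    with \<open>1 \<le> m - 1\<close> show ?R by (intro exI[of _ "[m - 1]"]) auto
  next
    assume "is_spider G"
    then obtain ns where "3 \<le> length ns" "\<forall>n\<in>set ns. n \<ge> 1"
      "digraph_iso (with_proj G) (with_proj (Sp ns))"
      by (auto simp: is_spider_def)
    then show ?R by (intro exI[of _ ns]) auto
  qed
next
  assume ?R
  then obtain ns where ns: "ns \<noteq> []" "\<forall>n\<in>set ns. n \<ge> 1"
    and iso: "digraph_iso (with_proj G) (with_proj (Sp ns))" by blast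
  have path: "is_path G" if "digraph_iso (with_proj (Sp ns)) (with_proj (path_graph (Suc m)))" for m
    unfolding is_path_def
    using digraph_iso_pair_trans[OF G pair_graph_Sp pair_graph_path_graph iso that]
    by (intro exI[of _ "Suc m"]) simp
  consider a where "ns = [a]" | a b where "ns = [a, b]" | "3 \<le> length ns"
  \<comment> \<open>The rule serves only to split lists into empty, singleton, and at least two
    elements.\<close>
  proof (cases ns rule: remdups_adj.cases)
    case (3 a b xs)
    then show ?thesis using that by (cases xs) auto
  qed (use ns(1) that in auto)
  then show "is_path G \<or> is_spider G"
  proof cases
    case 1
    then show ?thesis using path Sp_one_leg_iso_path by blast
  next
    case 2
    then show ?thesis using path Sp_two_legs_iso_path by blast
  next
    case 3
    then show ?thesis using ns iso by (auto simp: is_spider_def)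
  qed
qed

theorem corollary2p7:
  fixes G :: "'a pair_pre_digraph" and n :: nat
  assumes "pair_graph G"
    and "connected (with_proj G)"
    and "card (pverts G) = n"
    and "n \<ge> 2"
  shows "alpha_bn G = n - 1 \<longleftrightarrow> is_path G \<or> is_spider G"
proof -
  interpret connected_graph G
    using assms(1,2) by (simp add: connected_graph_def connected_graph_axioms_def)
  show ?thesis
    using alpha_bn_iff_Sp path_or_spider_iff_Sp[OF assms(1)] assms(3,4) by simp
qed

end
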